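(* Let $n,m,b$ be positive integers. There exists a first-stage algorithm with robustness factor at most $\overline{\rho}(m,b)+m/n$ for speed-robust scheduling of $n$ jobs of equal processing time (bricks) on $m$ machines with $b$ bags, where $\overline{\rho}(m,b)=\frac{m^b}{m^b-(m-1)^b}$.
   Context: Speed-robust scheduling: In the first stage, an algorithm receives positive integers $n,m,b$ and processing times $p_1,\dots,p_n\ge 0$ of $n$ jobs, and partitions the jobs into $b$ (possibly empty) bags; the size of a bag is the total processing time of its jobs. In the second stage, machine speeds $s_1,\dots,s_m\ge 0$ (not all zero) are revealed and each bag is assigned, as a whole, to one machine; a machine of speed $0$ receives no bags. Machine $i$ with bags of total size $A_i$ has completion time $A_i/s_i$ (or $0$ if $s_i=0$), and the makespan $C_{\max}$ is the maximum completion time. $C^*_{\max}$ denotes the optimal makespan of scheduling the jobs directly (each job as a whole on one machine) on these speeds. An algorithm has robustness factor at most $\rho$ (is $\rho$-robust) if for every instance and every choice of speeds there is an assignment of its bags with $C_{\max}\le\rho\,C^*_{\max}$. In the bricks case all processing times are equal: $p_1=\dots=p_n$. *)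

theory Defs
  imports Complex_Main "HOL-Library.FuncSet"
begin

text \<open>
  Jobs are \<open>{..<n}\<close>, machines \<open>{..<m}\<close>, bags \<open>{..<b}\<close>. A partition of the jobs into \<open>b\<close> possibly
  empty bags is a map from jobs to bags. Processing times, bag maps and assignments are extensional
  functions, so that nothing depends on values outside these index sets.
\<close>

definition processing_times :: "nat \<Rightarrow> (nat \<Rightarrow> real) set" where
  "processing_times n = {..<n} \<rightarrow>\<^sub>E {0..}"

definition bricks :: "nat \<Rightarrow> (nat \<Rightarrow> real) set" where
  "bricks n = {p \<in> processing_times n. \<forall>j<n. \<forall>k<n. p j = p k}"

definition speeds :: "nat \<Rightarrow> (nat \<Rightarrow> real) set" where
  "speeds m = {s. (\<forall>i<m. 0 \<le> s i) \<and> (\<exists>i<m. s i \<noteq> 0)}"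

definition bag_size :: "nat \<Rightarrow> (nat \<Rightarrow> real) \<Rightarrow> (nat \<Rightarrow> nat) \<Rightarrow> nat \<Rightarrow> real" where
  "bag_size n p \<beta> k = (\<Sum>j | j < n \<and> \<beta> j = k. p j)"

text \<open>
  The remaining scheduling notions are stated for \<open>N\<close> indivisible items of sizes \<open>w\<close>; the items are
  the bags in the second stage, and the jobs in the definition of the optimum.
\<close>

definition assignments :: "nat \<Rightarrow> nat \<Rightarrow> (nat \<Rightarrow> real) \<Rightarrow> (nat \<Rightarrow> nat) set" where
  "assignments N m s = {..<N} \<rightarrow>\<^sub>E {i. i < m \<and> s i \<noteq> 0}"

definition load :: "nat \<Rightarrow> (nat \<Rightarrow> real) \<Rightarrow> (nat \<Rightarrow> nat) \<Rightarrow> nat \<Rightarrow> real" where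
  "load N w f i = (\<Sum>k | k < N \<and> f k = i. w k)"

definition completion_time ::
  "nat \<Rightarrow> (nat \<Rightarrow> real) \<Rightarrow> (nat \<Rightarrow> real) \<Rightarrow> (nat \<Rightarrow> nat) \<Rightarrow> nat \<Rightarrow> real" where
  "completion_time N w s f i = (if s i = 0 then 0 else load N w f i / s i)"

definition makespan ::
  "nat \<Rightarrow> (nat \<Rightarrow> real) \<Rightarrow> nat \<Rightarrow> (nat \<Rightarrow> real) \<Rightarrow> (nat \<Rightarrow> nat) \<Rightarrow> real" where
  "makespan N w m s f = Max (completion_time N w s f ` {..<m})"

text \<open>The minimum ranges over a finite set, which is nonempty for \<open>s \<in> speeds m\<close>.\<close>

definition opt_makespan :: "nat \<Rightarrow> (nat \<Rightarrow> real) \<Rightarrow> nat \<Rightarrow> (nat \<Rightarrow> real) \<Rightarrow> real" where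
  "opt_makespan n p m s = Min (makespan n p m s ` assignments n m s)"

type_synonym algorithm = "nat \<Rightarrow> nat \<Rightarrow> nat \<Rightarrow> (nat \<Rightarrow> real) \<Rightarrow> nat \<Rightarrow> nat"

definition first_stage_algorithm :: "algorithm \<Rightarrow> bool" where
  "first_stage_algorithm A \<longleftrightarrow>
    (\<forall>n>0. \<forall>m>0. \<forall>b>0. \<forall>p\<in>processing_times n. A n m b p \<in> {..<n} \<rightarrow>\<^sub>E {..<b})"

text \<open>Robustness factor at most \<open>\<rho>\<close> on the instances with parameters \<open>n\<close>, \<open>m\<close>, \<open>b\<close> and processing
  times in \<open>P\<close>.\<close>

definition robust_on ::
  "nat \<Rightarrow> nat \<Rightarrow> nat \<Rightarrow> (nat \<Rightarrow> real) set \<Rightarrow> real \<Rightarrow> algorithm \<Rightarrow> bool" where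
  "robust_on n m b P \<rho> A \<longleftrightarrow>
    (\<forall>p\<in>P. \<forall>s\<in>speeds m. \<exists>g\<in>assignments b m s.
       makespan b (bag_size n p (A n m b p)) m s g \<le> \<rho> * opt_makespan n p m s)"

definition rho_bar :: "nat \<Rightarrow> nat \<Rightarrow> real" where
  "rho_bar m b = real m ^ b / (real m ^ b - (real m - 1) ^ b)"

end

theory Submission
  imports Defs
begin

text \<open>
  Suppose bags are placed one after another on machines of total capacity \<open>C\<close>. If every bag is at
  most a \<open>1/m\<close> fraction of the capacity left over by its predecessors, then by averaging it always
  fits on some machine. For unit bricks, let the capacity of a machine be \<open>\<rho>\<close> times its number of
  bricks in an optimal schedule, so that \<open>C = \<rho> n = rho_bar m b * n + m\<close>. Taking each bag as large
  as possible, rounding down costs less than one brick per bag, which the extra \<open>m\<close> absorbs: the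
  quantity \<open>rho_bar m b * n - (bricks packed so far)\<close> shrinks by a factor of at least
  \<open>1 - 1/m\<close> per bag, so after \<open>b\<close> bags all \<open>n\<close> bricks are packed.
\<close>

section \<open>Greedy packing by averaging\<close>

lemma sum_load:
  assumes "f \<in> {..<N} \<rightarrow> {..<m}"
  shows "(\<Sum>i<m. load N w f i) = (\<Sum>k<N. w k)"
proof -
  have "(\<Sum>i<m. sum w {k \<in> {..<N}. f k = i}) = sum w {..<N}"
    by (rule sum.group) (use assms in auto)
  then show ?thesis
    by (simp add: load_def)
qed

lemma load_fun_upd:
  "load (Suc N) w (f(N := i)) i' = load N w f i' + (if i' = i then w N else 0)"
proof -
  have "{k. k < Suc N \<and> (f(N := i)) k = i'}
      = {k. k < N \<and> f k = i'} \<union> (if i' = i then {N} else {})"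
    by auto
  then show ?thesis
    by (simp add: load_def)
qed

text \<open>The strict bound on the prefix sums keeps the average remaining capacity positive, so
  even an item of size 0 goes to a machine of positive capacity.\<close>

lemma greedy_packing:
  fixes w c :: "nat \<Rightarrow> real"
  assumes "m > 0"
    and "\<And>k. k < N \<Longrightarrow> 0 \<le> w k"
    and "\<And>k. k < N \<Longrightarrow> (\<Sum>j<k. w j) < (\<Sum>i<m. c i)"
    and "\<And>k. k < N \<Longrightarrow> real m * w k \<le> (\<Sum>i<m. c i) - (\<Sum>j<k. w j)"
    and "\<And>i. i < m \<Longrightarrow> 0 \<le> c i"
  shows "\<exists>f \<in> {..<N} \<rightarrow>\<^sub>E {i. i < m \<and> 0 < c i}. \<forall>i<m. load N w f i \<le> c i"
  using assms(2-4)
proof (induction N)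
  case 0
  show ?case
    by (simp add: load_def assms(5))
next
  case (Suc N)
  have "\<exists>f \<in> {..<N} \<rightarrow>\<^sub>E {i. i < m \<and> 0 < c i}. \<forall>i<m. load N w f i \<le> c i"
    by (rule Suc.IH; rule Suc.prems; simp)
  then obtain f where f: "f \<in> {..<N} \<rightarrow>\<^sub>E {i. i < m \<and> 0 < c i}"
    and le: "\<And>i. i < m \<Longrightarrow> load N w f i \<le> c i"
    by blast
  \<comment> \<open>\<open>R\<close> is the average remaining capacity, so some machine has at least
    \<open>R\<close> left.\<close>
  define R where "R = ((\<Sum>i<m. c i) - (\<Sum>j<N. w j)) / real m"
  have f_mem: "f \<in> {..<N} \<rightarrow> {..<m}"
    using PiE_mem[OF f] by simp
  have "(\<Sum>i<m. c i - load N w f i) = (\<Sum>i<m. c i) - (\<Sum>j<N. w j)"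
    by (simp add: sum_subtractf sum_load[OF f_mem])
  also have "\<dots> = (\<Sum>i<m. R)"
    using \<open>m > 0\<close> by (simp add: R_def)
  finally have eq: "(\<Sum>i<m. c i - load N w f i) = (\<Sum>i<m. R)" .
  have "\<exists>i<m. R \<le> c i - load N w f i"
  proof (rule ccontr)
    assume "\<not> ?thesis"
    then have "(\<Sum>i<m. c i - load N w f i) < (\<Sum>i<m. R)"
      using \<open>m > 0\<close> by (intro sum_strict_mono) (auto simp: not_le)
    with eq show False
      by simp
  qed
  then obtain i where i: "i < m" "R \<le> c i - load N w f i"
    by blast
  have "0 < R"
    using Suc.prems(2)[of N] \<open>m > 0\<close> by (simp add: R_def)
  moreover have "0 \<le> load N w f i"
    unfolding load_def by (rule sum_nonneg) (use Suc.prems(1) in auto)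
  ultimately have "0 < c i"
    using i by linarith
  have "w N \<le> R"
    using Suc.prems(3)[of N] \<open>m > 0\<close> by (simp add: R_def field_simps)
  with i have "w N \<le> c i - load N w f i"
    by linarith
  then have "\<forall>i'<m. load (Suc N) w (f(N := i)) i' \<le> c i'"
    using le by (auto simp: load_fun_upd)
  moreover have "f(N := i) \<in> {..<Suc N} \<rightarrow>\<^sub>E {i. i < m \<and> 0 < c i}"
    unfolding lessThan_Suc by (rule PiE_fun_upd[OF _ f]) (simp add: i(1) \<open>0 < c i\<close>)
  ultimately show ?case
    by blast
qed

section \<open>The constant \<open>rho_bar\<close> and the bag boundaries\<close>

text \<open>Dividing numerator and denominator by \<open>real m ^ b\<close> exposes the ratio
  \<open>1 - 1/m\<close> of the geometric decay; after \<open>b\<close> bags it leaves exactly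
  \<open>rho_bar m b * n - n\<close>.\<close>

lemma rho_bar_eq:
  assumes "m > 0" and "b > 0"
  shows "rho_bar m b * (1 - (1 - 1 / real m) ^ b) = 1"
proof -
  have "(real m - 1) ^ b < real m ^ b"
    by (rule power_strict_mono) (use assms in auto)
  moreover have "1 - 1 / real m = (real m - 1) / real m"
    using assms by (simp add: field_simps)
  ultimately show ?thesis
    using assms by (simp add: rho_bar_def power_divide field_simps)
qed

lemma rho_bar_ge_1:
  assumes "m > 0" and "b > 0"
  shows "1 \<le> rho_bar m b"
proof -
  have "(real m - 1) ^ b < real m ^ b"
    by (rule power_strict_mono) (use assms in auto)
  moreover have "0 \<le> (real m - 1) ^ b"
    using assms by simp
  ultimately show ?thesis
    by (simp add: rho_bar_def)
qed

text \<open>The number of bricks in the first \<open>k\<close> bags; bag \<open>k\<close> holds the bricks numbered from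
  \<open>packed n m b k\<close> up to \<open>packed n m b (Suc k) - 1\<close>.\<close>

fun packed :: "nat \<Rightarrow> nat \<Rightarrow> nat \<Rightarrow> nat \<Rightarrow> nat" where
  "packed n m b 0 = 0"
| "packed n m b (Suc k) =
     min n (packed n m b k
            + nat \<lfloor>(rho_bar m b * real n + real m - real (packed n m b k)) / real m\<rfloor>)"

declare packed.simps(2) [simp del]

section \<open>The first-stage algorithm\<close>

definition brick_algorithm :: algorithm where
  "brick_algorithm n m b p = (\<lambda>j\<in>{..<n}. LEAST k. j < packed n m b (Suc k))"

lemma packed_le: "packed n m b k \<le> n"
  by (cases k) (auto simp: packed.simps(2))

lemma mono_packed: "mono (packed n m b)"
  unfolding mono_iff_le_Suc by (auto simp: packed.simps(2) packed_le)

text \<open>This is the size condition of \<open>greedy_packing\<close> for total capacity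
  \<open>rho_bar m b * n + m\<close>; the floor and the cap at \<open>n\<close> can only shrink a
  bag.\<close>

lemma packed_step:
  assumes "m > 0" and "b > 0"
  shows "real m * (real (packed n m b (Suc k)) - real (packed n m b k))
    \<le> rho_bar m b * real n + real m - real (packed n m b k)"
proof -
  let ?x = "(rho_bar m b * real n + real m - real (packed n m b k)) / real m"
  have "real n \<le> rho_bar m b * real n"
    using rho_bar_ge_1[OF assms] mult_right_mono[of 1 "rho_bar m b" "real n"] by simp
  moreover have "real (packed n m b k) \<le> real n"
    by (simp add: packed_le)
  \<comment> \<open>\<open>nat\<close> sends negative floors to 0, so bounding the bag by
    \<open>?x\<close> requires \<open>?x\<close> to be nonnegative.\<close>
  ultimately have "0 \<le> ?x"
    by simp
  then have "real (packed n m b (Suc k)) - real (packed n m b k) \<le> ?x"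
    by (simp add: packed.simps(2)) linarith
  then show ?thesis
    using assms by (simp add: field_simps)
qed

lemma packed_lower_bound:
  assumes "m > 0"
  shows "packed n m b k = n \<or>
    rho_bar m b * real n - real (packed n m b k) \<le> rho_bar m b * real n * (1 - 1 / real m) ^ k"
proof (induction k)
  case 0
  then show ?case by simp
next
  case (Suc k)
  show ?case
  proof (cases "packed n m b (Suc k) = n")
    case True
    then show ?thesis ..
  next
    case False
    define S where "S = real (packed n m b k)"
    \<comment> \<open>A cap reached at \<open>k\<close> would persist at \<open>Suc k\<close>, so
      the induction hypothesis yields its second disjunct.\<close>
    have "packed n m b k \<noteq> n"
      using False by (auto simp: packed.simps(2))
    with Suc have IH: "rho_bar m b * real n - S \<le> rho_bar m b * real n * (1 - 1 / real m) ^ k"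
      by (simp add: S_def)
    have eq: "packed n m b (Suc k)
        = packed n m b k + nat \<lfloor>(rho_bar m b * real n + real m - S) / real m\<rfloor>"
      using False unfolding S_def by (auto simp: packed.simps(2) min_def)
    \<comment> \<open>The summand \<open>m\<close> is worth one whole brick, more than the floor
      loses.\<close>
    have "(rho_bar m b * real n + real m - S) / real m = (rho_bar m b * real n - S) / real m + 1"
      using assms by (simp add: field_simps)
    then have "S + (rho_bar m b * real n - S) / real m \<le> real (packed n m b (Suc k))"
      unfolding eq S_def by linarith
    then have "rho_bar m b * real n - real (packed n m b (Suc k))
        \<le> (rho_bar m b * real n - S) * (1 - 1 / real m)"
      by (simp add: right_diff_distrib)
    also have "\<dots> \<le> rho_bar m b * real n * (1 - 1 / real m) ^ k * (1 - 1 / real m)"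
      by (rule mult_right_mono[OF IH]) (use assms in simp)
    finally show ?thesis
      by (simp add: mult_ac)
  qed
qed

lemma packed_all:
  assumes "m > 0" and "b > 0"
  shows "packed n m b b = n"
  using packed_lower_bound[OF assms(1), of n b b]
proof
  assume "rho_bar m b * real n - real (packed n m b b)
    \<le> rho_bar m b * real n * (1 - 1 / real m) ^ b"
  then have "rho_bar m b * (1 - (1 - 1 / real m) ^ b) * real n \<le> real (packed n m b b)"
    by (simp add: algebra_simps)
  then show ?thesis
    using packed_le[of n m b b] by (simp add: rho_bar_eq[OF assms])
qed

text \<open>Monotonicity of \<open>packed\<close> makes the intervals of the bags disjoint, and
  \<open>packed_all\<close> makes them cover all bricks.\<close>

lemma brick_algorithm_eq_iff:
  assumes "m > 0" and "b > 0" and "j < n"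
  shows "brick_algorithm n m b p j = k \<longleftrightarrow> packed n m b k \<le> j \<and> j < packed n m b (Suc k)"
proof -
  let ?P = "\<lambda>k. j < packed n m b (Suc k)"
  have "?P (b - 1)"
    using packed_all[OF assms(1,2)] assms by simp
  then have ex: "?P (LEAST k. ?P k)"
    by (rule LeastI)
  have lower: "packed n m b (LEAST k. ?P k) \<le> j"
  proof (cases "LEAST k. ?P k")
    \<comment> \<open>By leastness the preceding bag ends at or before brick \<open>j\<close>; bag 0
      starts at 0 anyway.\<close>
    case (Suc l)
    then have "\<not> ?P l"
      by (metis not_less_Least lessI)
    then show ?thesis
      unfolding Suc by linarith
  qed simp
  have "k = k'"
    if "packed n m b k \<le> j" "?P k" "packed n m b k' \<le> j" "?P k'" for k k'
  proof (rule ccontr)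
    assume "k \<noteq> k'"
    then have "Suc k \<le> k' \<or> Suc k' \<le> k"
      by linarith
    then show False
      using that monoD[OF mono_packed] by (metis le_less_trans not_le)
  qed
  then show ?thesis
    using ex lower assms(3) unfolding brick_algorithm_def by (auto)
qed

lemma first_stage_brick_algorithm: "first_stage_algorithm brick_algorithm"
  unfolding first_stage_algorithm_def
proof (intro allI impI ballI PiE_I)
  fix n m b :: nat and p j
  assume "m > 0" "b > 0" and j: "j \<in> {..<n}"
  \<comment> \<open>The interval of brick \<open>j\<close> starts at or before
    \<open>j < n = packed n m b b\<close>, so by monotonicity its index is below
    \<open>b\<close>.\<close>
  then have less: "packed n m b (brick_algorithm n m b p j) < packed n m b b"
    using brick_algorithm_eq_iff[of m b j n p "brick_algorithm n m b p j"] by (simp add: packed_all)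
  have "\<not> b \<le> brick_algorithm n m b p j"
  proof
    assume "b \<le> brick_algorithm n m b p j"
    from monoD[OF mono_packed this] less show False
      by (meson not_le)
  qed
  then show "brick_algorithm n m b p j \<in> {..<b}"
    by simp
qed (simp add: brick_algorithm_def)

lemma bag_size_brick_algorithm:
  assumes "m > 0" and "b > 0" and "\<And>j. j < n \<Longrightarrow> p j = v"
  shows "bag_size n p (brick_algorithm n m b p) k
    = v * (real (packed n m b (Suc k)) - real (packed n m b k))"
proof -
  have "j < n \<and> brick_algorithm n m b p j = k \<longleftrightarrow>
      j \<in> {packed n m b k..<packed n m b (Suc k)}" for j
    using packed_le[of n m b "Suc k"] brick_algorithm_eq_iff[OF assms(1,2)] by auto
  then have "{j. j < n \<and> brick_algorithm n m b p j = k} = {packed n m b k..<packed n m b (Suc k)}"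
    by blast
  moreover have "packed n m b k \<le> packed n m b (Suc k)"
    by (rule monoD[OF mono_packed]) simp
  moreover have "p j = v" if "j < packed n m b (Suc k)" for j
    using that assms(3) packed_le less_le_trans by blast
  ultimately show ?thesis
    by (simp add: bag_size_def of_nat_diff)
qed

section \<open>Makespans and the robustness factor\<close>

lemma opt_makespan_attained:
  assumes "s \<in> speeds m"
  shows "\<exists>f \<in> assignments n m s. makespan n p m s f = opt_makespan n p m s"
proof -
  have "finite (assignments n m s)"
    unfolding assignments_def by (rule finite_PiE) auto
  moreover have "assignments n m s \<noteq> {}"
    using assms by (auto simp: assignments_def speeds_def PiE_eq_empty_iff)
  ultimately have "opt_makespan n p m s \<in> makespan n p m s ` assignments n m s"
    unfolding opt_makespan_def by (intro Min_in) auto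
  then show ?thesis
    by auto
qed

lemma makespan_mono:
  assumes "s \<in> speeds m" and "0 \<le> \<rho>"
    and "\<And>i. i < m \<Longrightarrow> load N w g i \<le> \<rho> * load N' w' f i"
  shows "makespan N w m s g \<le> \<rho> * makespan N' w' m s f"
proof -
  have "completion_time N w s g i \<le> \<rho> * makespan N' w' m s f" if "i < m" for i
  proof -
    have "0 \<le> s i"
      using assms(1) that by (auto simp: speeds_def)
    \<comment> \<open>On a machine of speed 0 both completion times are 0 by definition.\<close>
    then have "completion_time N w s g i \<le> \<rho> * completion_time N' w' s f i"
      using divide_right_mono[OF assms(3)[OF that]] by (simp add: completion_time_def)
    also have "\<dots> \<le> \<rho> * makespan N' w' m s f"
      unfolding makespan_def by (rule mult_left_mono) (use that assms(2) in auto)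
    finally show ?thesis .
  qed
  moreover have "m > 0"
    using assms(1) by (auto simp: speeds_def)
  ultimately show ?thesis
    unfolding makespan_def[of N] by (subst Max_le_iff) auto
qed

lemma robust_brick_algorithm:
  assumes "n > 0" and "m > 0" and "b > 0"
  shows "robust_on n m b (bricks n) (rho_bar m b + real m / real n) brick_algorithm"
  unfolding robust_on_def
proof (intro ballI)
  fix p s
  assume p: "p \<in> bricks n" and s: "s \<in> speeds m"
  define \<rho> where "\<rho> = rho_bar m b + real m / real n"
  define v where "v = p 0"
  have pv: "p j = v" if "j < n" for j
    using p that assms(1) unfolding bricks_def v_def by blast
  have "p \<in> {..<n} \<rightarrow>\<^sub>E {0..}"
    using p unfolding bricks_def processing_times_def by blast
  then have "0 \<le> v"
    using assms(1) PiE_mem[of p "{..<n}" "\<lambda>_. {0..}" 0] by (simp add: v_def)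
  have "0 < real m / real n"
    using assms by simp
  then have "1 < \<rho>"
    using rho_bar_ge_1[OF assms(2,3)] unfolding \<rho>_def by linarith
  obtain f where f: "f \<in> assignments n m s" "makespan n p m s f = opt_makespan n p m s"
    using opt_makespan_attained[OF s] by blast
  have f_mem': "f k < m" "s (f k) \<noteq> 0" if "k < n" for k
    using PiE_mem[OF f(1)[unfolded assignments_def], of k] that by simp_all
  then have f_mem: "f \<in> {..<n} \<rightarrow> {..<m}"
    by auto
  text \<open>Packing is done with unit bricks, since \<open>v\<close> may be \<open>0\<close>.\<close>
  define w where "w k = real (packed n m b (Suc k)) - real (packed n m b k)" for k
  define c where "c i = \<rho> * load n (\<lambda>_. 1) f i" for i
  \<comment> \<open>The total is the same for all speeds and every optimal \<open>f\<close>; hence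
    the bags can be fixed before the speeds are known.\<close>
  have sum_c: "(\<Sum>i<m. c i) = \<rho> * real n"
    using sum_load[OF f_mem, of "\<lambda>_. 1"] by (simp add: c_def sum_distrib_left[symmetric])
  have sum_w: "(\<Sum>j<k. w j) = real (packed n m b k)" for k
    unfolding w_def by (subst sum_lessThan_telescope) simp
  have "\<exists>g \<in> {..<b} \<rightarrow>\<^sub>E {i. i < m \<and> 0 < c i}. \<forall>i<m. load b w g i \<le> c i"
  proof (rule greedy_packing)
    show "0 \<le> w k" for k
      unfolding w_def using monoD[OF mono_packed, of k "Suc k"] by simp
    show "(\<Sum>j<k. w j) < (\<Sum>i<m. c i)" for k
    proof -
      have "real (packed n m b k) \<le> real n"
        by (simp add: packed_le)
      also have "\<dots> < \<rho> * real n"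
        using \<open>1 < \<rho>\<close> assms(1) by simp
      finally show ?thesis
        by (simp add: sum_c sum_w)
    qed
    \<comment> \<open>The term \<open>m / n\<close> of the factor becomes the extra capacity
      \<open>m\<close>.\<close>
    have "\<rho> * real n = rho_bar m b * real n + real m"
      using assms(1) by (simp add: \<rho>_def field_simps)
    then show "real m * w k \<le> (\<Sum>i<m. c i) - (\<Sum>j<k. w j)" for k
      using packed_step[OF assms(2,3), of n k] unfolding sum_c sum_w unfolding w_def by simp
    show "0 \<le> c i" for i
      using \<open>1 < \<rho>\<close> by (simp add: c_def load_def)
  qed (rule assms)
  then obtain g where g: "g \<in> {..<b} \<rightarrow>\<^sub>E {i. i < m \<and> 0 < c i}"
    and le: "\<And>i. i < m \<Longrightarrow> load b w g i \<le> c i"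
    by blast
  \<comment> \<open>Positive capacity means that \<open>f\<close> uses the machine, so its speed is
    nonzero and \<open>g\<close> is a legal assignment.\<close>
  have "s i \<noteq> 0" if "0 < c i" for i
  proof
    assume "s i = 0"
    then have "{k. k < n \<and> f k = i} = {}"
      using f_mem'(2) by auto
    with that show False
      by (simp add: c_def load_def)
  qed
  then have "{..<b} \<rightarrow>\<^sub>E {i. i < m \<and> 0 < c i} \<subseteq> assignments b m s"
    unfolding assignments_def by (intro PiE_mono) auto
  with g have "g \<in> assignments b m s"
    by (rule rev_subsetD)
  moreover have "makespan b (bag_size n p (brick_algorithm n m b p)) m s g
      \<le> \<rho> * makespan n p m s f"
  proof (rule makespan_mono[OF s])
    fix i assume "i < m"
    \<comment> \<open>Scaling by the common processing time \<open>v\<close> turns brick counts back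
      into sizes.\<close>
    have "load b (bag_size n p (brick_algorithm n m b p)) g i = v * load b w g i"
      unfolding load_def w_def
      by (simp add: bag_size_brick_algorithm[OF assms(2,3) pv] sum_distrib_left)
    also have "\<dots> \<le> v * c i"
      using le[OF \<open>i < m\<close>] \<open>0 \<le> v\<close> by (rule mult_left_mono)
    also have "\<dots> = \<rho> * load n p f i"
      using pv by (simp add: c_def load_def)
    finally show "load b (bag_size n p (brick_algorithm n m b p)) g i \<le> \<rho> * load n p f i" .
  qed (use \<open>1 < \<rho>\<close> in simp)
  ultimately show "\<exists>g\<in>assignments b m s.
      makespan b (bag_size n p (brick_algorithm n m b p)) m s g
      \<le> (rho_bar m b + real m / real n) * opt_makespan n p m s"
    unfolding f(2) \<rho>_def by blast
qed

theorem theorem6: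
  fixes n m b :: nat
  assumes "n > 0" and "m > 0" and "b > 0"
  shows "\<exists>A. first_stage_algorithm A \<and>
             robust_on n m b (bricks n) (rho_bar m b + real m / real n) A"
  using first_stage_brick_algorithm robust_brick_algorithm[OF assms] by blast

end
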